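(* Let $m$ be a nonnegative integer, $I\in\mathbb S$, $f\in L^2_{\mathbb H}(\mathbb R;dt)$, and let $\varphi(t)=e^{-\frac{t^2}{2}}H_m(-t)$. Then, for every $q=x+Iy$ with $x,y\in\mathbb R$, $$V_I(f,\varphi)(q)=\sqrt{\sqrt\pi\,m!}\;2^{\frac{m-1}{2}}\,e^{-\frac{|q|^2}{4}}\,[\mathcal B_mf]\!\left(\overline{\frac{x+Iy}{\sqrt2}}\right).$$
   Context: $\mathbb H$ is the division algebra of real quaternions and $\mathbb S=\{q\in\mathbb H:q^2=-1\}$. $L^2_{\mathbb H}(\mathbb R;dt)$ is the space of square integrable $\mathbb H$-valued functions on $\mathbb R$, and $H_m(x)=(-1)^me^{x^2}\frac{d^m}{dx^m}e^{-x^2}$ is the real Hermite polynomial. For $f,g\in L^2_{\mathbb H}(\mathbb R;dt)$, the left-sided quaternionic Fourier-Wigner transform is $$V_I(f,g)(x+Iy)=\frac{1}{\sqrt{2\pi}}\int_{\mathbb R}e^{Iyt}f\!\left(t+\frac x2\right)g\!\left(t-\frac x2\right)dt,\qquad x,y\in\mathbb R.$$ The generalized quaternionic Segal-Bargmann transform is $$[\mathcal B_m\phi](q)=\frac{1}{\pi^{3/4}\sqrt{2^mm!}}\int_{\mathbb R}e^{-\frac{t^2}{2}-\frac{\overline q^{\,2}}{2}+\sqrt2\,\overline q\,t}\,H_m\!\left(\frac{q+\overline q}{\sqrt2}-t\right)\phi(t)\,dt,\qquad q\in\mathbb H.$$ *)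

theory Defs
  imports "HOL-Analysis.Analysis"
begin

section \<open>The division algebra of real quaternions\<close>

datatype quat = Quat (qre: real) (qim1: real) (qim2: real) (qim3: real)

lemma quat_eq_iff:
  "p = q \<longleftrightarrow> qre p = qre q \<and> qim1 p = qim1 q \<and> qim2 p = qim2 q \<and> qim3 p = qim3 q"
  by (cases p; cases q) simp

instantiation quat :: ab_group_add
begin

definition "0 = Quat 0 0 0 0"
definition "p + q = Quat (qre p + qre q) (qim1 p + qim1 q) (qim2 p + qim2 q) (qim3 p + qim3 q)"
definition "- q = Quat (- qre q) (- qim1 q) (- qim2 q) (- qim3 q)"
definition "p - q = Quat (qre p - qre q) (qim1 p - qim1 q) (qim2 p - qim2 q) (qim3 p - qim3 q)"

instance
  by standard
    (simp_all add: quat_eq_iff zero_quat_def plus_quat_def uminus_quat_def minus_quat_def)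

end

lemma quat_add_sel [simp]:
  "qre 0 = 0" "qim1 0 = 0" "qim2 0 = 0" "qim3 0 = 0"
  "qre (p + q) = qre p + qre q" "qim1 (p + q) = qim1 p + qim1 q"
  "qim2 (p + q) = qim2 p + qim2 q" "qim3 (p + q) = qim3 p + qim3 q"
  "qre (- q) = - qre q" "qim1 (- q) = - qim1 q" "qim2 (- q) = - qim2 q" "qim3 (- q) = - qim3 q"
  "qre (p - q) = qre p - qre q" "qim1 (p - q) = qim1 p - qim1 q"
  "qim2 (p - q) = qim2 p - qim2 q" "qim3 (p - q) = qim3 p - qim3 q"
  by (simp_all add: zero_quat_def plus_quat_def uminus_quat_def minus_quat_def)

instantiation quat :: ring_1
begin

definition "1 = Quat 1 0 0 0"

definition "p * q = Quat
  (qre p * qre q - qim1 p * qim1 q - qim2 p * qim2 q - qim3 p * qim3 q)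
  (qre p * qim1 q + qim1 p * qre q + qim2 p * qim3 q - qim3 p * qim2 q)
  (qre p * qim2 q - qim1 p * qim3 q + qim2 p * qre q + qim3 p * qim1 q)
  (qre p * qim3 q + qim1 p * qim2 q - qim2 p * qim1 q + qim3 p * qre q)"

instance
  by standard
    (simp_all add: quat_eq_iff one_quat_def times_quat_def, simp_all add: algebra_simps)

end

lemma quat_mult_sel [simp]:
  "qre 1 = 1" "qim1 1 = 0" "qim2 1 = 0" "qim3 1 = 0"
  "qre (p * q) = qre p * qre q - qim1 p * qim1 q - qim2 p * qim2 q - qim3 p * qim3 q"
  "qim1 (p * q) = qre p * qim1 q + qim1 p * qre q + qim2 p * qim3 q - qim3 p * qim2 q"
  "qim2 (p * q) = qre p * qim2 q - qim1 p * qim3 q + qim2 p * qre q + qim3 p * qim1 q"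
  "qim3 (p * q) = qre p * qim3 q + qim1 p * qim2 q - qim2 p * qim1 q + qim3 p * qre q"
  by (simp_all add: one_quat_def times_quat_def)

instantiation quat :: real_vector
begin

definition "r *\<^sub>R q = Quat (r * qre q) (r * qim1 q) (r * qim2 q) (r * qim3 q)"

instance
  by standard (simp_all add: quat_eq_iff scaleR_quat_def algebra_simps)

end

lemma quat_scaleR_sel [simp]:
  "qre (r *\<^sub>R q) = r * qre q" "qim1 (r *\<^sub>R q) = r * qim1 q"
  "qim2 (r *\<^sub>R q) = r * qim2 q" "qim3 (r *\<^sub>R q) = r * qim3 q"
  by (simp_all add: scaleR_quat_def)

instantiation quat :: real_inner
begin

definition "p \<bullet> q = qre p * qre q + qim1 p * qim1 q + qim2 p * qim2 q + qim3 p * qim3 q"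
definition "norm (q :: quat) = sqrt (q \<bullet> q)"
definition "dist (p :: quat) q = norm (p - q)"
definition "sgn (q :: quat) = q /\<^sub>R norm q"
definition "(uniformity :: (quat \<times> quat) filter) =
  (INF e\<in>{0<..}. principal {(p, q). dist p q < e})"
definition "open (U :: quat set) \<longleftrightarrow>
  (\<forall>p\<in>U. \<forall>\<^sub>F (p', q) in uniformity. p' = p \<longrightarrow> q \<in> U)"

instance
proof
  fix p q s :: quat and r :: real
  show "p \<bullet> q = q \<bullet> p" "(p + q) \<bullet> s = p \<bullet> s + q \<bullet> s" "(r *\<^sub>R p) \<bullet> q = r * (p \<bullet> q)"
    by (simp_all add: inner_quat_def algebra_simps)
  show "0 \<le> p \<bullet> p"
    by (simp add: inner_quat_def)
  show "p \<bullet> p = 0 \<longleftrightarrow> p = 0"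
    by (simp add: inner_quat_def quat_eq_iff add_nonneg_eq_0_iff)
qed (rule norm_quat_def dist_quat_def sgn_quat_def uniformity_quat_def open_quat_def)+

end

definition qcnj :: "quat \<Rightarrow> quat"
  where "qcnj q = Quat (qre q) (- qim1 q) (- qim2 q) (- qim3 q)"

lemma qcnj_sel [simp]:
  "qre (qcnj q) = qre q" "qim1 (qcnj q) = - qim1 q"
  "qim2 (qcnj q) = - qim2 q" "qim3 (qcnj q) = - qim3 q"
  by (simp_all add: qcnj_def)

instantiation quat :: real_normed_div_algebra
begin

definition "inverse q = qcnj q /\<^sub>R (q \<bullet> q)"
definition "p div q = p * inverse (q :: quat)"

instance
proof
  fix p q :: quat and r :: real
  have left: "r *\<^sub>R p * q = r *\<^sub>R (p * q)" and right: "p * r *\<^sub>R q = r *\<^sub>R (p * q)"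
    for p q :: quat and r
    by (simp_all add: quat_eq_iff algebra_simps)
  show "r *\<^sub>R p * q = r *\<^sub>R (p * q)" "p * r *\<^sub>R q = r *\<^sub>R (p * q)"
    by (rule left right)+
  have cnj: "qcnj q * q = (q \<bullet> q) *\<^sub>R 1" "q * qcnj q = (q \<bullet> q) *\<^sub>R 1" for q
    by (simp_all add: quat_eq_iff inner_quat_def)
  show "inverse q * q = 1" "q * inverse q = 1" if "q \<noteq> 0"
    using that by (simp_all add: inverse_quat_def cnj left right)
  show "inverse (0 :: quat) = 0"
    by (simp add: inverse_quat_def quat_eq_iff)
  show "p div q = p * inverse q"
    by (rule divide_quat_def)
  have "(p * q) \<bullet> (p * q) = (p \<bullet> p) * (q \<bullet> q)"
    unfolding inner_quat_def quat_mult_sel by (simp add: algebra_simps)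
  then show "norm (p * q) = norm p * norm q"
    by (simp add: norm_quat_def real_sqrt_mult)
qed

end

instantiation quat :: euclidean_space
begin

definition "Basis = {Quat 1 0 0 0, Quat 0 1 0 0, Quat 0 0 1 0, Quat 0 0 0 1}"

instance
proof
  fix p q :: quat
  show "(Basis :: quat set) \<noteq> {}" "finite (Basis :: quat set)"
    unfolding Basis_quat_def by blast+
  show "p \<bullet> q = (if p = q then 1 else 0)" if "p \<in> Basis" "q \<in> Basis"
    using that unfolding Basis_quat_def inner_quat_def by (elim insertE emptyE; simp)
  show "(\<forall>q\<in>Basis. p \<bullet> q = 0) \<longleftrightarrow> p = 0"
    unfolding Basis_quat_def inner_quat_def quat_eq_iff by (simp add: conj_ac)
qed

end

lemma quat_of_real_sel [simp]:
  "qre (of_real r) = r" "qim1 (of_real r) = 0" "qim2 (of_real r) = 0" "qim3 (of_real r) = 0"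
  by (simp_all add: of_real_def)

definition unit_sphere :: "quat set"
  where "unit_sphere = {q. q\<^sup>2 = - 1}"


section \<open>Square integrable functions and Hermite polynomials\<close>

text \<open>Elements of the space are represented by functions rather than by classes modulo null sets.\<close>

definition L2_quat :: "(real \<Rightarrow> quat) set"
  where "L2_quat =
    {f. f \<in> borel_measurable lebesgue \<and> integrable lebesgue (\<lambda>t. (norm (f t))\<^sup>2)}"

definition hermite :: "nat \<Rightarrow> real \<Rightarrow> real"
  where "hermite m x = (- 1) ^ m * exp (x\<^sup>2) * (deriv ^^ m) (\<lambda>s. exp (- s\<^sup>2)) x"


section \<open>The two transforms\<close>

text \<open>For \<^term>\<open>I \<in> unit_sphere\<close> and \<^term>\<open>q\<close> in the slice spanned by \<^term>\<open>1\<close> and \<^term>\<open>I\<close>,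
  \<open>slice_im I q\<close> is the coordinate \<open>y\<close> in \<open>q = x + I y\<close>; it is unspecified off that slice.\<close>

definition slice_im :: "quat \<Rightarrow> quat \<Rightarrow> real"
  where "slice_im I q = (THE y. q = of_real (qre q) + I * of_real y)"

definition fourier_wigner :: "quat \<Rightarrow> (real \<Rightarrow> quat) \<Rightarrow> (real \<Rightarrow> quat) \<Rightarrow> quat \<Rightarrow> quat"
  where "fourier_wigner I f g q =
    (let x = qre q; y = slice_im I q in
      (1 / sqrt (2 * pi)) *\<^sub>R
        (LINT t|lebesgue. exp (I * of_real y * of_real t) * f (t + x / 2) * g (t - x / 2)))"

text \<open>The argument of the Hermite polynomial is the real quaternion
  \<open>(q + qcnj q) / sqrt 2 - t\<close>, read as a real number.\<close>

definition segal_bargmann :: "nat \<Rightarrow> (real \<Rightarrow> quat) \<Rightarrow> quat \<Rightarrow> quat"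
  where "segal_bargmann m \<phi> q =
    (1 / (pi powr (3 / 4) * sqrt (2 ^ m * fact m))) *\<^sub>R
      (LINT t|lebesgue.
        exp (- (of_real t)\<^sup>2 / 2 - (qcnj q)\<^sup>2 / 2 + of_real (sqrt 2) * qcnj q * of_real t)
        * of_real (hermite m (qre (q + qcnj q) / sqrt 2 - t)) * \<phi> t)"

lemma unit_sphere_qre:
  assumes "I \<in> unit_sphere"
  shows "qre I = 0"
proof (rule ccontr)
  assume "qre I \<noteq> 0"
  moreover have "I * I = - 1"
    using assms by (simp add: unit_sphere_def power2_eq_square)
  ultimately have "qim1 I = 0" "qim2 I = 0" "qim3 I = 0" "qre I * qre I = - 1"
    by (auto simp: quat_eq_iff)
  then show False
    by (metis not_square_less_zero neg_less_0_iff_less zero_less_one)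
qed

lemma qre_slice:
  assumes "I \<in> unit_sphere"
  shows "qre (of_real x + I * of_real y) = x"
  by (simp add: unit_sphere_qre[OF assms])

lemma slice_im_eq:
  assumes "I \<in> unit_sphere"
  shows "slice_im I (of_real x + I * of_real y) = y"
proof -
  have "I \<noteq> 0"
    using assms by (auto simp: unit_sphere_def)
  show ?thesis
    unfolding slice_im_def qre_slice[OF assms]
  proof (rule the_equality)
    fix z
    assume "of_real x + I * of_real y = of_real x + I * of_real z"
    then have "I * of_real y = I * of_real z"
      by (rule add_left_imp_eq)
    then show "z = y"
      using \<open>I \<noteq> 0\<close> by simp
  qed (rule refl)
qed

lemma fourier_wigner_eq:
  assumes "I \<in> unit_sphere"
  shows "fourier_wigner I f g (of_real x + I * of_real y) =
    (1 / sqrt (2 * pi)) *\<^sub>R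
      (LINT t|lebesgue. exp (I * of_real y * of_real t) * f (t + x / 2) * g (t - x / 2))"
  unfolding fourier_wigner_def Let_def qre_slice[OF assms] slice_im_eq[OF assms] by (rule refl)

end

theory Submission
  imports Defs
begin

text \<open>
  Translating the variable of the Fourier-Wigner integral by \<open>x / 2\<close> leaves \<open>f\<close> evaluated at the
  integration variable itself and turns the window into \<open>exp (- (t - x)\<^sup>2 / 2)\<close> times \<open>H\<^sub>m (x - t)\<close>,
  next to the phase \<open>exp (I y (t - x / 2))\<close>. On the other side, put \<open>w = q / sqrt 2\<close>. The Bargmann
  exponent at the conjugate of \<open>w\<close> lies in the commutative slice spanned by \<open>1\<close> and \<open>I\<close>, and
  completing the square there gives
  \<open>- t\<^sup>2 / 2 - w\<^sup>2 / 2 + sqrt 2 w t = (x\<^sup>2 + y\<^sup>2) / 4 - (t - x)\<^sup>2 / 2 + I y (t - x / 2)\<close>.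
  The term \<open>(x\<^sup>2 + y\<^sup>2) / 4\<close> is cancelled by the Gaussian factor in \<open>norm q\<close>, and what remains is
  the Fourier-Wigner integrand. The two integrands thus agree pointwise, with the quaternionic
  factors in the same order: \<open>f t\<close> stands to the right of the exponential on both sides, and every
  factor moved across it is real, hence central. The pointwise identity is
  \<open>segal_bargmann_kernel\<close>; \<open>bargmann_constant\<close> matches the normalisations.

  An affine substitution and a real scalar factor preserve integrability in both directions, so the
  corresponding rules are equations between Bochner integrals.
\<close>

text \<open>The exponential law needs summands that commute; a real summand is central.\<close>

lemma exp_of_real_add:
  fixes b :: "'a::{real_normed_algebra_1,banach}"
  shows "exp (of_real a + b) = exp a *\<^sub>R exp b"
proof -
  have "exp (of_real a + b) = exp (of_real a) * exp b"
    by (rule exp_add_commuting) (simp add: of_real_def)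
  also have "exp (of_real a :: 'a) = of_real (exp a)"
    by (rule exp_of_real)
  finally show ?thesis
    by (simp add: scaleR_conv_of_real)
qed

lemma unit_sphere_mult_self:
  assumes "I \<in> unit_sphere"
  shows "I * I = - 1"
  using assms by (simp add: unit_sphere_def power2_eq_square)

lemma slice_square:
  assumes "I \<in> unit_sphere"
  shows "(of_real x + I * of_real y)\<^sup>2 = of_real (x\<^sup>2 - y\<^sup>2) + (2 * x * y) *\<^sub>R I"
proof -
  have "(of_real x + I * of_real y)\<^sup>2 = (x *\<^sub>R 1 + y *\<^sub>R I) * (x *\<^sub>R 1 + y *\<^sub>R I)"
    by (simp add: power2_eq_square of_real_def)
  also have "\<dots> = (x * x) *\<^sub>R 1 + (2 * x * y) *\<^sub>R I + (y * y) *\<^sub>R (I * I)"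
    by (simp add: algebra_simps flip: scaleR_2)
  also have "\<dots> = of_real (x\<^sup>2 - y\<^sup>2) + (2 * x * y) *\<^sub>R I"
    unfolding unit_sphere_mult_self[OF assms]
    by (simp add: of_real_def power2_eq_square algebra_simps)
  finally show ?thesis .
qed

text \<open>An imaginary unit has norm \<open>1\<close> and real part \<open>0\<close>, so \<open>1\<close> and \<open>I\<close> are orthonormal.\<close>

lemma norm_slice_square:
  assumes "I \<in> unit_sphere"
  shows "(norm (of_real x + I * of_real y))\<^sup>2 = x\<^sup>2 + y\<^sup>2"
proof -
  have "(norm I)\<^sup>2 = norm (I * I)"
    by (simp add: norm_mult power2_eq_square)
  then have "I \<bullet> I = 1"
    by (simp add: unit_sphere_mult_self[OF assms] power2_norm_eq_inner)
  moreover have "qre I = 0"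
    by (rule unit_sphere_qre[OF assms])
  ultimately have "y\<^sup>2 * ((qim1 I)\<^sup>2 + (qim2 I)\<^sup>2 + (qim3 I)\<^sup>2) = y\<^sup>2"
    by (simp add: inner_quat_def power2_eq_square)
  then show ?thesis
    using \<open>qre I = 0\<close> unfolding power2_norm_eq_inner
    by (simp add: inner_quat_def power2_eq_square algebra_simps)
qed

text \<open>Completing the square: the real part of \<open>- w\<^sup>2 / 2\<close> is \<open>(y\<^sup>2 - x\<^sup>2) / 4\<close>, and borrowing
  \<open>- x\<^sup>2 / 2\<close> from it to form \<open>- (t - x)\<^sup>2 / 2\<close> leaves \<open>(x\<^sup>2 + y\<^sup>2) / 4\<close>; the cross term of \<open>w\<^sup>2\<close>
  shifts the frequency term \<open>y t\<close> by \<open>- x y / 2\<close>.\<close>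

lemma segal_bargmann_exponent:
  fixes x y t :: real
  assumes "I \<in> unit_sphere"
  defines "w \<equiv> (of_real x + I * of_real y) / of_real (sqrt 2)"
  shows "- (of_real t)\<^sup>2 / 2 - w\<^sup>2 / 2 + of_real (sqrt 2) * w * of_real t =
    of_real ((x\<^sup>2 + y\<^sup>2) / 4 - (t - x)\<^sup>2 / 2) + (y * (t - x / 2)) *\<^sub>R I"
proof -
  let ?z = "of_real x + I * of_real y"
  have half: "p / 2 = (1 / 2) *\<^sub>R p" for p :: quat
    using of_real_inverse[of 2, where 'a = quat]
    by (metis divide_inverse inverse_eq_divide mult.right_neutral mult_scaleR_right of_real_def of_real_numeral)
  have w: "w = (1 / sqrt 2) *\<^sub>R ?z"
    unfolding w_def divide_inverse of_real_inverse[symmetric] by (simp add: of_real_def)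
  have "w\<^sup>2 = (1 / 2) *\<^sub>R ?z\<^sup>2"
    unfolding w power2_eq_square by simp
  then have sq: "w\<^sup>2 = (1 / 2) *\<^sub>R (of_real (x\<^sup>2 - y\<^sup>2) + (2 * x * y) *\<^sub>R I)"
    by (simp add: slice_square[OF assms(1)])
  have lin: "of_real (sqrt 2) * w * of_real t = of_real (x * t) + (y * t) *\<^sub>R I"
    unfolding w by (simp add: of_real_def algebra_simps)
  have "(of_real t :: quat)\<^sup>2 = of_real (t\<^sup>2)"
    by simp
  then show ?thesis
    unfolding half sq lin
    by (simp add: quat_eq_iff del: of_real_add of_real_diff of_real_mult of_real_divide of_real_power)
      (simp add: power2_eq_square field_simps)
qed

text \<open>The factor \<open>exp (- (x\<^sup>2 + y\<^sup>2) / 4)\<close> cancels the constant left by completing the square, so that the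
  Bargmann kernel becomes a Gaussian centred at \<open>x\<close> with a phase: the kernel of the Fourier-Wigner
  integral after translation.\<close>

lemma segal_bargmann_kernel:
  fixes x y t :: real
  assumes "I \<in> unit_sphere"
  defines "w \<equiv> (of_real x + I * of_real y) / of_real (sqrt 2)"
  shows "exp (- (x\<^sup>2 + y\<^sup>2) / 4) *\<^sub>R
      exp (- (of_real t)\<^sup>2 / 2 - w\<^sup>2 / 2 + of_real (sqrt 2) * w * of_real t) =
    exp (- (t - x)\<^sup>2 / 2) *\<^sub>R exp (I * of_real y * of_real (t - x / 2))"
proof -
  have I: "(y * (t - x / 2)) *\<^sub>R I = I * of_real y * of_real (t - x / 2)"
    unfolding mult.assoc of_real_mult[symmetric] by (simp add: of_real_def)
  show ?thesis
    unfolding w_def segal_bargmann_exponent[OF assms(1)] exp_of_real_add I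
    by (simp flip: exp_add) (simp add: field_simps)
qed

lemma bargmann_constant:
  "sqrt (sqrt pi * fact m) * 2 powr ((real m - 1) / 2) / (pi powr (3 / 4) * sqrt (2 ^ m * fact m))
    = 1 / sqrt (2 * pi)"
proof -
  have "sqrt (sqrt pi) = pi powr (1 / 4)"
    by (simp add: powr_half_sqrt[symmetric] powr_powr)
  moreover have "pi powr (3 / 4) = pi powr (1 / 4) * sqrt pi"
    by (simp add: powr_half_sqrt[symmetric] flip: powr_add)
  moreover have "2 powr ((real m - 1) / 2) = sqrt (2 ^ m) / sqrt 2"
    by (simp add: powr_half_sqrt[symmetric] powr_realpow[symmetric] powr_powr diff_divide_distrib powr_diff)
  ultimately show ?thesis
    by (simp add: real_sqrt_mult)
qed

theorem theorem7p4:
  fixes m :: nat and I q :: quat and f :: "real \<Rightarrow> quat" and x y :: real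
  assumes "I \<in> unit_sphere"
    and "f \<in> L2_quat"
    and "q = of_real x + I * of_real y"
  shows "fourier_wigner I f (\<lambda>t. of_real (exp (- t\<^sup>2 / 2) * hermite m (- t))) q =
    (sqrt (sqrt pi * fact m) * 2 powr ((real m - 1) / 2) * exp (- (norm q)\<^sup>2 / 4)) *\<^sub>R
      segal_bargmann m f (qcnj ((of_real x + I * of_real y) / of_real (sqrt 2)))"
proof -
  define w where "w = (of_real x + I * of_real y) / of_real (sqrt 2)"
  define K where "K t = exp (- (of_real t)\<^sup>2 / 2 - w\<^sup>2 / 2 + of_real (sqrt 2) * w * of_real t)
    * of_real (hermite m (x - t)) * f t" for t :: real
  define h where "h t = exp (I * of_real y * of_real t) * f (t + x / 2) *
    of_real (exp (- (t - x / 2)\<^sup>2 / 2) * hermite m (- (t - x / 2)))" for t :: real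
  have cnj: "qcnj (qcnj w) = w"
    by (simp add: quat_eq_iff)
  have "qre w = x / sqrt 2"
  proof -
    have "w = (1 / sqrt 2) *\<^sub>R (of_real x + I * of_real y)"
      unfolding w_def divide_inverse of_real_inverse[symmetric] by (simp add: of_real_def)
    then show ?thesis
      by (simp add: unit_sphere_qre[OF assms(1)])
  qed
  then have arg: "qre (qcnj w + w) / sqrt 2 = x"
    by (simp add: add_divide_distrib)
  \<comment> \<open>The factor \<open>1 *\<close> is the slope in the affine substitution rule that is used for the translation.\<close>
  have kernel: "h (- (x / 2) + 1 * t) = exp (- (norm q)\<^sup>2 / 4) *\<^sub>R K t" for t
  proof -
    have "h (- (x / 2) + 1 * t) = exp (I * of_real y * of_real (t - x / 2)) * f t *
        of_real (exp (- (t - x)\<^sup>2 / 2) * hermite m (x - t))"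
      unfolding h_def by (simp add: algebra_simps del: of_real_diff of_real_add)
    also have "\<dots> = (exp (- (t - x)\<^sup>2 / 2) *\<^sub>R exp (I * of_real y * of_real (t - x / 2))) *
        of_real (hermite m (x - t)) * f t"
      by (simp add: of_real_def del: of_real_diff)
    also have "\<dots> = exp (- (norm q)\<^sup>2 / 4) *\<^sub>R K t"
      unfolding segal_bargmann_kernel[OF assms(1), symmetric] K_def w_def assms(3)
        norm_slice_square[OF assms(1)] by simp
    finally show ?thesis .
  qed
  have "fourier_wigner I f (\<lambda>t. of_real (exp (- t\<^sup>2 / 2) * hermite m (- t))) q =
      (1 / sqrt (2 * pi)) *\<^sub>R (LINT t|lebesgue. h t)"
    unfolding assms(3) fourier_wigner_eq[OF assms(1)] h_def ..
  also have "(LINT t|lebesgue. h t) = (LINT t|lebesgue. h (- (x / 2) + 1 * t))"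
    using lebesgue_integral_real_affine[of 1 h "- (x / 2)"] by simp
  also have "\<dots> = exp (- (norm q)\<^sup>2 / 4) *\<^sub>R (LINT t|lebesgue. K t)"
    unfolding kernel by simp
  finally show ?thesis
    unfolding segal_bargmann_def w_def[symmetric] cnj arg K_def[symmetric]
      bargmann_constant[of m, symmetric]
    by (simp only: scaleR_scaleR times_divide_eq_left times_divide_eq_right
      mult_1_left mult_1_right mult_ac)
qed

end
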